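(* Let $m$ and $n$ be two even positive integers with $m\leq n$, and let $p$ be a positive integer. A magic column rectangle $MCR(m^{(1)},n^{(1)};p)$ exists if and only if both of the following hold: (i) $m+n\equiv 0 \pmod 4$; and (ii) $1=2(2pn+1)^2-(2pm+2pn+1)^2$ or $m\geq (\sqrt{2}-1)n+\frac{\sqrt{2}-1}{2p}$.
   Context: A magic column rectangle $MCR(m^{(1)},n^{(1)};p)$ (with $m\le n$) is an $(m+n)\times p$ matrix whose entries are $1,2,\ldots,(m+n)p$, each appearing exactly once, which is partitioned into two blocks, the first consisting of $m$ rows (an $m\times p$ submatrix) and the second of the remaining $n$ rows (an $n\times p$ submatrix), such that the sum of the entries in every column of each block is the same constant (necessarily $\frac{(m+n)(mp+np+1)}{4}$). *)

theory Defs
  imports Complex_Main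
begin

definition is_MCR :: "nat \<Rightarrow> nat \<Rightarrow> nat \<Rightarrow> (nat \<Rightarrow> nat \<Rightarrow> nat) \<Rightarrow> bool" where
  "is_MCR m n p A \<longleftrightarrow>
     bij_betw (\<lambda>(i, j). A i j) ({0..<m+n} \<times> {0..<p}) {1..(m+n)*p} \<and>
     (\<exists>c. \<forall>j<p. (\<Sum>i<m. A i j) = c \<and> (\<Sum>i\<in>{m..<m+n}. A i j) = c)"

definition MCR_exists :: "nat \<Rightarrow> nat \<Rightarrow> nat \<Rightarrow> bool" where
  "MCR_exists m n p \<longleftrightarrow> (\<exists>A. is_MCR m n p A)"

end

theory Submission
  imports Defs
begin

text \<open>
  Let $N = (m + n) p$. Double counting gives $4 c = (m + n)(N + 1)$ with $N + 1$ odd, and the $np$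
  distinct entries of the second block sum to at least $np(np + 1)/2$; clearing denominators, this
  bound is condition (ii), whose first alternative is the case of equality.

  Conversely, cut $1, \ldots, N$ into $m + n$ intervals of length $p$ and use each as a row,
  alternately increasing and decreasing. Giving the intervals with index in $S$ to the first block
  makes all columns constant within each block, and moving $S$ changes the column sum of the first
  block in steps of $p$. With $n - m = 4d$, it remains to raise that sum by $r = d \bmod p$. If
  $k \in S$ and $k + 1 \notin S$, shift the row $k$ up by $r$; the row $k + 1$ of the second block
  then has its first $r$ entries lowered by $p$, and rotating one further row of the second block
  by $r$ makes the column sums constant again. The bound says exactly that the required $S$ exists.
\<close>

section \<open>Elementary sums of natural numbers\<close>

lemma sum_alternating_even_length:
  fixes x y :: nat
  assumes "even l"
  shows "(\<Sum>i\<in>{l..<l + 2 * a}. if even i then x else y) = a * (x + y)"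
proof (induction a)
  case (Suc a)
  have "{l..<l + 2 * Suc a} = insert (Suc (l + 2 * a)) (insert (l + 2 * a) {l..<l + 2 * a})"
    by auto
  then show ?case using Suc assms by simp
qed simp

text \<open>By induction, removing the maximum: the largest of \<open>q\<close> distinct positive
  integers is at least \<open>q\<close>.\<close>

lemma sum_ge_triangular:
  fixes S :: "nat set"
  assumes "finite S" "0 \<notin> S" "card S = q"
  shows "q * (q + 1) \<le> 2 * \<Sum>S"
  using assms
proof (induction q arbitrary: S)
  case (Suc q)
  define M where "M = Max S"
  have "S \<noteq> {}" using Suc.prems by auto
  then have M: "M \<in> S" using Suc.prems by (simp add: M_def)
  have "S \<subseteq> {1..M}" using Suc.prems by (auto simp: M_def Suc_le_eq intro: gr0I)
  from card_mono[OF _ this] have "Suc q \<le> M" using Suc.prems by simp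
  moreover have "q * (q + 1) \<le> 2 * \<Sum>(S - {M})"
    using Suc.IH[of "S - {M}"] Suc.prems M by simp
  moreover have "\<Sum>S = M + \<Sum>(S - {M})"
    using Suc.prems M by (simp add: sum.remove)
  ultimately show ?case by simp
qed simp

lemma sum_nat_lessThan_double: "2 * \<Sum>{..<N::nat} = N * (N - 1)"
proof (induction N)
  case (Suc N)
  then show ?case by (cases N) (simp_all add: lessThan_Suc)
qed simp

section \<open>Index sets and row permutations of prescribed sum\<close>

lemma upward_closed_eq_top:
  fixes S :: "nat set"
  assumes "S \<subseteq> {..<N}" "S \<noteq> {}" and up: "\<And>k. k \<in> S \<Longrightarrow> Suc k < N \<Longrightarrow> Suc k \<in> S"
  shows "S = {N - card S..<N}"
proof -
  have fin: "finite S" using assms finite_subset by blast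
  define a where "a = Min S"
  have a: "a \<in> S" using fin assms by (simp add: a_def)
  have "b \<in> S" if "a \<le> b" "b < N" for b
    using that by (induction b rule: dec_induct) (auto simp: a intro: up)
  then have "S = {a..<N}" using fin assms(1) by (auto simp: a_def)
  moreover have "a < N" using a assms by auto
  ultimately show ?thesis by simp
qed

text \<open>Starting from \<open>{..<m}\<close>, replacing some \<open>k\<close> by a free
  \<open>Suc k\<close> raises the sum by exactly one. By \<open>upward_closed_eq_top\<close> this is
  blocked only at \<open>{n..<m + n}\<close>, where \<open>t = m * n\<close>. So every value in
  between is reached, and below the maximum some pair \<open>k\<close>, \<open>Suc k\<close> is
  separated by \<open>S\<close>, as the later shift requires.\<close>

lemma exists_index_set_with_sum:
  fixes m n t :: nat
  assumes "t \<le> m * n"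
  shows "\<exists>S \<subseteq> {..<m + n}. card S = m \<and> \<Sum>S = \<Sum>{..<m} + t \<and>
           (t < m * n \<longrightarrow> (\<exists>k\<in>S. Suc k < m + n \<and> Suc k \<notin> S))"
proof -
  have step: "\<exists>k\<in>S. Suc k < m + n \<and> Suc k \<notin> S"
    if S: "S \<subseteq> {..<m + n}" "card S = m" "\<Sum>S = \<Sum>{..<m} + t" and t: "t < m * n" for S t
  proof (rule ccontr)
    assume "\<not> ?thesis"
    moreover have "S \<noteq> {}" using S t by auto
    ultimately have "S = {n..<m + n}"
      using upward_closed_eq_top[of S "m + n"] S by auto
    then have "\<Sum>S = (\<Sum>i\<in>{0..<m}. i + n)"
      using sum.shift_bounds_nat_ivl[of "\<lambda>x. x" 0 n m] by simp
    also have "\<dots> = \<Sum>{..<m} + m * n" by (simp add: sum.distrib atLeast0LessThan)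
    finally show False using S t by simp
  qed
  have "\<exists>S \<subseteq> {..<m + n}. card S = m \<and> \<Sum>S = \<Sum>{..<m} + t"
    using assms
  proof (induction t)
    case 0
    show ?case by (rule exI[of _ "{..<m}"]) auto
  next
    case (Suc t)
    then obtain S where S: "S \<subseteq> {..<m + n}" "card S = m" "\<Sum>S = \<Sum>{..<m} + t" by auto
    obtain k where k: "k \<in> S" "Suc k < m + n" "Suc k \<notin> S"
      using step[OF S] Suc.prems by auto
    have fin: "finite S" using S finite_subset by blast
    let ?S = "insert (Suc k) (S - {k})"
    have "card ?S = m" using k fin S(2) card_Suc_Diff1[OF fin k(1)] by simp
    moreover have "\<Sum>S = k + \<Sum>(S - {k})" using k fin by (simp add: sum.remove)
    then have "\<Sum>?S = \<Sum>{..<m} + Suc t" using k fin S(3) by simp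
    ultimately show ?case using S k by (intro exI[of _ ?S]) auto
  qed
  then obtain S where S: "S \<subseteq> {..<m + n}" "card S = m" "\<Sum>S = \<Sum>{..<m} + t" by blast
  show ?thesis using S step[OF S] by (intro exI[of _ S]) simp
qed

lemma exists_bij_betw_with_first:
  fixes l c :: nat
  assumes "finite S" "card S = c" "x \<in> S"
  shows "\<exists>f. bij_betw f {l..<l + c} S \<and> f l = x"
proof -
  obtain h where h: "bij_betw h {l..<l + c} S"
    using assms by (metis card_atLeastLessThan diff_add_inverse finite_atLeastLessThan
        finite_same_card_bij)
  then obtain i where i: "i \<in> {l..<l + c}" "h i = x"
    using assms(3) by (auto simp: bij_betw_def)
  let ?f = "h(l := x, i := h l)"
  have "?f = h \<circ> (id(l := i, i := l))" using i by (auto simp: fun_eq_iff)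
  moreover have "bij_betw (id(l := i, i := l)) {l..<l + c} {l..<l + c}"
    using i by (intro bij_betw_byWitness[where f' = "id(l := i, i := l)"]) auto
  ultimately have "bij_betw ?f {l..<l + c} S" using h bij_betw_trans by metis
  moreover have "?f l = x" using i by auto
  ultimately show ?thesis by blast
qed

text \<open>The first \<open>m\<close> values list the set \<open>S\<close> of
  \<open>exists_index_set_with_sum\<close>, the others its complement. The separated pair is put at
  positions \<open>0\<close> and \<open>m\<close>, the first row of each block, so that the shift
  acts on known rows.\<close>

lemma exists_row_permutation:
  fixes m n t :: nat
  assumes "t \<le> m * n" "0 < m"
  shows "\<exists>\<pi>. bij_betw \<pi> {..<m + n} {..<m + n} \<and> (\<Sum>i<m. \<pi> i) = \<Sum>{..<m} + t \<and>
           (t < m * n \<longrightarrow> \<pi> m = Suc (\<pi> 0))"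
proof -
  obtain S where S: "S \<subseteq> {..<m + n}" "card S = m" "\<Sum>S = \<Sum>{..<m} + t"
    and k: "t < m * n \<longrightarrow> (\<exists>k\<in>S. Suc k < m + n \<and> Suc k \<notin> S)"
    using exists_index_set_with_sum[OF assms(1)] by blast
  let ?C = "{..<m + n} - S"
  have fin: "finite S" using S finite_subset by blast
  have C: "finite ?C" "card ?C = n" using S fin by (auto simp: card_Diff_subset)
  obtain f g where f: "bij_betw f {0..<0 + m} S" and g: "bij_betw g {m..<m + n} ?C"
    and fg: "t < m * n \<longrightarrow> g m = Suc (f 0)"
  proof (cases "t < m * n")
    case True
    then obtain k where "k \<in> S" "Suc k \<in> ?C" using k by auto
    then show thesis
      using exists_bij_betw_with_first[OF fin S(2), of k 0]
        exists_bij_betw_with_first[OF C, of "Suc k" m] that by metis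
  next
    case False
    obtain f where "bij_betw f {0..<0 + m} S"
      using fin S(2) by (metis card_atLeastLessThan diff_add_inverse finite_atLeastLessThan
        finite_same_card_bij)
    moreover obtain g where "bij_betw g {m..<m + n} ?C"
      using C by (metis card_atLeastLessThan diff_add_inverse finite_atLeastLessThan
        finite_same_card_bij)
    ultimately show thesis using that False by blast
  qed
  let ?\<pi> = "\<lambda>i. if i < m then f i else g i"
  have f': "bij_betw ?\<pi> {0..<m} S" using f by (subst bij_betw_cong[of _ _ f]) auto
  have "bij_betw ?\<pi> {m..<m + n} ?C" using g by (subst bij_betw_cong[of _ _ g]) auto
  with f' have "bij_betw ?\<pi> ({0..<m} \<union> {m..<m + n}) (S \<union> ?C)"
    by (rule bij_betw_combine) auto
  moreover have "{0..<m} \<union> {m..<m + n} = {..<m + n}" "S \<union> ?C = {..<m + n}" using S by auto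
  ultimately have "bij_betw ?\<pi> {..<m + n} {..<m + n}" by simp
  moreover have "(\<Sum>i<m. ?\<pi> i) = \<Sum>S"
    using sum.reindex_bij_betw[OF f', of "\<lambda>x. x"] by (simp add: atLeast0LessThan)
  moreover have "t < m * n \<longrightarrow> ?\<pi> m = Suc (?\<pi> 0)" using fg assms by simp
  ultimately show ?thesis using S(3) by (intro exI[of _ ?\<pi>]) simp
qed

section \<open>Shifted and rotated rows, and the rectangle built from them\<close>

text \<open>
  Zero-based: the interval \<open>k\<close> is shifted up by \<open>r\<close>, and the first \<open>r\<close> entries of the interval \<open>k + 1\<close>
  fill the gap that this leaves.
\<close>
definition rotate_blocks :: "nat \<Rightarrow> nat \<Rightarrow> nat \<Rightarrow> nat \<Rightarrow> nat" where
  "rotate_blocks p k r x =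
     (if k * p \<le> x \<and> x < k * p + p then x + r
      else if k * p + p \<le> x \<and> x < k * p + p + r then x - p else x)"

lemma inj_rotate_blocks: "inj (rotate_blocks p k r)"
  by (rule injI) (auto simp: rotate_blocks_def split: if_splits)

text \<open>Both corrections are written as additions to avoid truncated subtraction. As
  \<open>r < p\<close>, the lowered entries all lie in the interval \<open>Suc k\<close>.\<close>

lemma rotate_blocks_in_block:
  assumes "v < p" "r < p"
  shows "rotate_blocks p k r (p * q + v) + (if q = Suc k \<and> v < r then p else 0)
           = p * q + v + (if q = k then r else 0)"
proof -
  consider "q = k" | "q = Suc k" | "q < k" | "Suc k < q" by linarith
  then show ?thesis
  proof cases
    case 3
    then have "p * Suc q \<le> p * k" by (intro mult_le_mono2) simp
    then show ?thesis using 3 assms by (simp add: rotate_blocks_def algebra_simps)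
  next
    case 4
    then have "p * Suc (Suc k) \<le> p * q" by (intro mult_le_mono2) simp
    then show ?thesis using 4 assms by (simp add: rotate_blocks_def algebra_simps)
  qed (use assms in \<open>auto simp: rotate_blocks_def algebra_simps\<close>)
qed

text \<open>The exceptional row \<open>l\<close> is the rotated one; \<open>l\<close> must be even for its neighbours to cancel.\<close>
definition row_entry :: "nat \<Rightarrow> nat \<Rightarrow> nat \<Rightarrow> nat \<Rightarrow> nat \<Rightarrow> nat" where
  "row_entry p r l i j =
     (if i = l then (j + (p - r)) mod p else if even i then j else p - 1 - j)"

lemma row_entry_less: "j < p \<Longrightarrow> row_entry p r l i j < p"
  by (simp add: row_entry_def)

text \<open>The rotation takes \<open>r\<close> from every entry and returns \<open>p\<close> to the
  first \<open>r\<close> of them. The latter compensates the loss of \<open>p\<close> in the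
  interval \<open>k + 1\<close>.\<close>

lemma add_mod_shift:
  fixes j p r :: nat
  assumes "j < p" "r < p"
  shows "(j + (p - r)) mod p + r = j + (if j < r then p else 0)"
proof (cases "j < r")
  case True
  then show ?thesis using assms by simp
next
  case False
  then have "j + (p - r) = (j - r) + p" using assms by simp
  then have "(j + (p - r)) mod p = (j - r + p) mod p" by (rule arg_cong)
  then have "(j + (p - r)) mod p = j - r" using assms by simp
  then show ?thesis using False by simp
qed

lemma row_entry_inj:
  assumes "row_entry p r l i j = row_entry p r l i j'" "j < p" "j' < p" "r < p"
  shows "j = j'"
proof (cases "i = l")
  case True
  then show ?thesis
    using assms add_mod_shift[of j p r] add_mod_shift[of j' p r]
    by (auto simp: row_entry_def split: if_splits)
qed (use assms in \<open>auto simp: row_entry_def split: if_splits\<close>)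

text \<open>Row \<open>i\<close> carries the interval \<open>\<pi> i\<close>. Apart from the
  multiples of \<open>p\<close>, an increasing and a decreasing row together add
  \<open>p - 1\<close> to each column, and counting entries from 1 adds 2 more. The shift adds
  \<open>r\<close> to the first block, and shift and rotation together take \<open>r\<close> from
  the second. \<open>balance\<close> equates the two column sums, with the last \<open>r\<close>
  moved to the left.\<close>

lemma MCR_exists_from_permutation:
  fixes a b p r :: nat
  assumes \<pi>: "bij_betw \<pi> {..<2 * a + 2 * b} {..<2 * a + 2 * b}"
    and "0 < a" "r < p"
    and shift: "0 < r \<Longrightarrow> 2 \<le> b \<and> \<pi> (2 * a) = Suc (\<pi> 0)"
    and balance: "p * (\<Sum>i<2 * a. \<pi> i) + r + a * (p - 1) + 2 * a + r =
      p * (\<Sum>i\<in>{2 * a..<2 * a + 2 * b}. \<pi> i) + b * (p - 1) + 2 * b"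
  shows "MCR_exists (2 * a) (2 * b) p"
proof -
  define m n where "m = 2 * a" and "n = 2 * b"
  define k where "k = \<pi> 0"
  \<comment> \<open>Row \<open>m\<close> carries the interval lowered by the shift and must stay
    increasing, so that the loss falls on the columns \<open>j < r\<close>. The next even row of the
    second block is \<open>m + 2\<close>, present if \<open>2 \<le> b\<close>. For
    \<open>r = 0\<close> the rotation is the identity, so the row may then be absent.\<close>
  define w where "w = row_entry p r (m + 2)"
  define A where "A = (\<lambda>i j. Suc (rotate_blocks p k r (p * \<pi> i + w i j)))"
  have \<pi>': "bij_betw \<pi> {..<m + n} {..<m + n}" using \<pi> by (simp add: m_def n_def)
  have \<pi>_inj: "\<pi> i = \<pi> i' \<longleftrightarrow> i = i'" if "i < m + n" "i' < m + n" for i i'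
    using \<pi>' that by (auto simp: bij_betw_def inj_on_eq_iff)
  have \<pi>_less: "\<pi> i < m + n" if "i < m + n" for i
    using \<pi>' that by (auto simp: bij_betw_def)
  have w_less: "w i j < p" if "j < p" for i j
    using that by (simp add: w_def row_entry_less)
  have m0: "0 < m" using assms by (simp add: m_def)
  have entry: "A i j + (if i = m \<and> j < r then p else 0)
      = Suc (p * \<pi> i + w i j + (if i = 0 then r else 0))" if "i < m + n" "j < p" for i j
  proof -
    have "\<pi> i = k \<longleftrightarrow> i = 0" using that m0 by (simp add: k_def \<pi>_inj)
    moreover have "\<pi> i = Suc k \<and> w i j < r \<longleftrightarrow> i = m \<and> j < r"
    proof (cases "r = 0")
      case False
      then have "2 \<le> b" "\<pi> m = Suc k" using shift by (auto simp: m_def k_def)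
      then have "\<pi> i = Suc k \<longleftrightarrow> i = m" using that \<pi>_inj[of i m] by (auto simp: n_def)
      moreover have "w m j = j" by (simp add: w_def row_entry_def m_def)
      ultimately show ?thesis by auto
    qed simp
    ultimately show ?thesis
      using rotate_blocks_in_block[OF w_less[OF that(2)] assms(3), of k "\<pi> i" i]
      by (simp add: A_def)
  qed
  have "inj_on (\<lambda>(i, j). A i j) ({0..<m + n} \<times> {0..<p})"
  proof (rule inj_onI, clarsimp)
    fix i j i' j' assume *: "i < m + n" "j < p" "i' < m + n" "j' < p" "A i j = A i' j'"
    then have eq: "p * \<pi> i + w i j = p * \<pi> i' + w i' j'"
      using inj_rotate_blocks by (auto simp: A_def dest: injD)
    have "\<pi> i = (p * \<pi> i + w i j) div p" using * w_less[of j i] by simp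
    also have "\<dots> = \<pi> i'" unfolding eq using * w_less[of j' i'] by simp
    finally have i: "i = i'" using * \<pi>_inj by simp
    then have "w i j = w i j'" using eq by simp
    then show "i = i' \<and> j = j'" using i * assms(3) row_entry_inj by (auto simp: w_def)
  qed
  moreover have "(\<lambda>(i, j). A i j) ` ({0..<m + n} \<times> {0..<p}) \<subseteq> {1..(m + n) * p}"
  proof clarsimp
    fix i j assume ij: "i < m + n" "j < p"
    have *: "p * q + v < (m + n) * p" if "q < m + n" "v < p" for q v
    proof -
      have "p * Suc q \<le> p * (m + n)" using that by (intro mult_le_mono2) simp
      then show ?thesis using that by (simp add: algebra_simps)
    qed
    have "A i j \<le> (m + n) * p"
    proof (cases "i = 0 \<and> 0 < r")
      \<comment> \<open>Row \<open>0\<close> may run over into the interval \<open>Suc k\<close>,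
        which still lies in the range because row \<open>m\<close> carries it.\<close>
      case True
      then have "2 \<le> b" "\<pi> m = Suc k" using shift by (auto simp: m_def k_def)
      then have "p * Suc k + w i j < (m + n) * p"
        using *[of "Suc k" "w i j"] \<pi>_less[of m] w_less[OF ij(2)] by (simp add: n_def)
      then show ?thesis using entry[OF ij] True m0 assms(3) by (simp add: k_def algebra_simps)
    next
      case False
      then show ?thesis
        using entry[OF ij] *[OF \<pi>_less[OF ij(1)] w_less[OF ij(2), of i]]
        by (auto split: if_splits)
    qed
    then show "Suc 0 \<le> A i j \<and> A i j \<le> (m + n) * p" by (simp add: A_def)
  qed
  ultimately have "bij_betw (\<lambda>(i, j). A i j) ({0..<m + n} \<times> {0..<p}) {1..(m + n) * p}"
    unfolding bij_betw_def by (intro conjI card_subset_eq) (auto simp: card_image)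
  moreover have "(\<Sum>i<m. A i j) = p * (\<Sum>i<m. \<pi> i) + r + a * (p - 1) + 2 * a" if "j < p" for j
  proof -
    have "A i j = p * \<pi> i + (if even i then j else p - 1 - j) + 1 + (if i = 0 then r else 0)"
      if "i < m" for i
      using entry[of i j] that \<open>j < p\<close> by (simp add: w_def row_entry_def)
    then have "(\<Sum>i<m. A i j) =
        (\<Sum>i<m. p * \<pi> i + (if even i then j else p - 1 - j) + 1 + (if i = 0 then r else 0))"
      by (intro sum.cong) auto
    also have "\<dots> = p * (\<Sum>i<m. \<pi> i) + a * (j + (p - 1 - j)) + m + r"
      using sum_alternating_even_length[of 0 j "p - 1 - j" a] m0
      by (simp only: sum.distrib) (simp add: sum_distrib_left m_def atLeast0LessThan)
    finally show ?thesis using that by (simp add: m_def)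
  qed
  moreover have "(\<Sum>i\<in>{m..<m + n}. A i j) + r =
      p * (\<Sum>i\<in>{m..<m + n}. \<pi> i) + b * (p - 1) + 2 * b" if j: "j < p" for j
  proof -
    let ?I = "{m..<m + n}"
    \<comment> \<open>The losses, \<open>p\<close> in row \<open>m\<close> and \<open>r\<close> in
      row \<open>m + 2\<close>, are added on the left; the gain of \<open>p\<close> in row
      \<open>m + 2\<close> stands on the right. After summation the two terms in \<open>p\<close>
      cancel in every column.\<close>
    have "A i j + (if i = m \<and> j < r then p else 0) + (if i = m + 2 then r else 0) =
        p * \<pi> i + (if even i then j else p - 1 - j) + 1 + (if i = m + 2 \<and> j < r then p else 0)"
      if "i \<in> ?I" for i
      using entry[of i j] that j add_mod_shift[OF j assms(3)] m0
      by (auto simp: w_def row_entry_def m_def)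
    then have "(\<Sum>i\<in>?I. A i j + (if i = m \<and> j < r then p else 0) + (if i = m + 2 then r else 0)) =
      (\<Sum>i\<in>?I. p * \<pi> i + (if even i then j else p - 1 - j) + 1 + (if i = m + 2 \<and> j < r then p else 0))"
      by (intro sum.cong) auto
    also have "\<dots> = p * (\<Sum>i\<in>?I. \<pi> i) + b * (j + (p - 1 - j)) + n +
        (\<Sum>i\<in>?I. if i = m + 2 \<and> j < r then p else 0)"
      using sum_alternating_even_length[of m j "p - 1 - j" b]
      by (simp only: sum.distrib) (simp add: sum_distrib_left m_def n_def)
    finally have main: "(\<Sum>i\<in>?I. A i j) + (\<Sum>i\<in>?I. if i = m \<and> j < r then p else 0)
        + (\<Sum>i\<in>?I. if i = m + 2 then r else 0) = p * (\<Sum>i\<in>?I. \<pi> i) + b * (p - 1) + 2 * b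
        + (\<Sum>i\<in>?I. if i = m + 2 \<and> j < r then p else 0)"
      using j by (simp add: sum.distrib n_def)
    show ?thesis
    proof (cases "r = 0")
      case True
      then show ?thesis using main by (simp split: if_splits)
    next
      case False
      then have "2 \<le> b" using shift by auto
      then have "m \<in> ?I" "m + 2 \<in> ?I" by (auto simp: n_def)
      then show ?thesis using main by (cases "j < r") simp_all
    qed
  qed
  then have "(\<Sum>i\<in>{m..<m + n}. A i j) = p * (\<Sum>i<m. \<pi> i) + r + a * (p - 1) + 2 * a"
    if "j < p" for j
    using that balance unfolding m_def n_def by (metis add_right_cancel)
  ultimately have "is_MCR m n p A"
    unfolding is_MCR_def by blast
  then show ?thesis by (auto simp: MCR_exists_def m_def n_def)
qed

section \<open>Necessity\<close>

lemma MCR_exists_imp: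
  assumes "MCR_exists m n p" "even m" "even n" "0 < p"
  shows "(m + n) mod 4 = 0" "2 * n * (n * p + 1) \<le> (m + n) * ((m + n) * p + 1)"
proof -
  obtain A c where
    bij: "bij_betw (\<lambda>(i, j). A i j) ({0..<m + n} \<times> {0..<p}) {1..(m + n) * p}"
    and c: "\<And>j. j < p \<Longrightarrow> (\<Sum>i<m. A i j) = c" "\<And>j. j < p \<Longrightarrow> (\<Sum>i\<in>{m..<m + n}. A i j) = c"
    using assms(1) unfolding MCR_exists_def is_MCR_def by blast
  define N where "N = (m + n) * p"
  have total: "(\<Sum>i\<in>I. \<Sum>j<p. A i j) = (\<Sum>j<p. \<Sum>i\<in>I. A i j)" for I
    by (rule sum.swap)
  have "2 * \<Sum>{1..N} = N * (N + 1)"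
    by (induction N) (auto simp: algebra_simps)
  moreover have "\<Sum>{1..N} = (\<Sum>j<p. \<Sum>i\<in>{0..<m + n}. A i j)"
    using sum.reindex_bij_betw[OF bij, of "\<lambda>x. x"] total[of "{0..<m + n}"]
    by (simp add: N_def case_prod_unfold sum.cartesian_product atLeast0LessThan)
  moreover have "(\<Sum>i\<in>{0..<m + n}. A i j) = 2 * c" if "j < p" for j
    using sum.atLeastLessThan_concat[of 0 m "m + n" "\<lambda>i. A i j"] c[OF that]
    by (simp add: atLeast0LessThan)
  ultimately have "p * (4 * c) = p * ((m + n) * (N + 1))" by (simp add: N_def algebra_simps)
  then have 4: "4 * c = (m + n) * (N + 1)" using assms(4) by (metis mult_left_cancel neq0_conv)
  \<comment> \<open>\<open>N\<close> is even because \<open>m + n\<close> is, so the factor 4 must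
    divide \<open>m + n\<close>.\<close>
  have "coprime 4 (N + 1)"
  proof -
    have "odd (N + 1)" using assms by (simp add: N_def)
    then have "coprime (2 ^ 2) (N + 1)"
      using coprime_left_2_iff_odd coprime_power_left_iff by blast
    then show ?thesis by simp
  qed
  moreover have "4 dvd (m + n) * (N + 1)" by (metis 4 dvd_triv_left)
  ultimately show "(m + n) mod 4 = 0" using coprime_dvd_mult_left_iff by (metis dvd_imp_mod_0)
  let ?D = "{m..<m + n} \<times> {0..<p}"
  let ?B = "(\<lambda>(i, j). A i j) ` ?D"
  have inj: "inj_on (\<lambda>(i, j). A i j) ?D"
    using bij by (rule inj_on_subset[OF bij_betw_imp_inj_on]) auto
  have "?B \<subseteq> (\<lambda>(i, j). A i j) ` ({0..<m + n} \<times> {0..<p})" by (intro image_mono) auto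
  also have "\<dots> = {1..N}" using bij by (simp add: bij_betw_def N_def)
  finally have "?B \<subseteq> {1..N}" .
  then have "0 \<notin> ?B" by auto
  then have "(n * p) * (n * p + 1) \<le> 2 * \<Sum>?B"
    by (intro sum_ge_triangular) (auto simp: card_image[OF inj])
  also have "\<Sum>?B = (\<Sum>(i, j)\<in>?D. A i j)"
    by (subst sum.reindex[OF inj]) (simp add: case_prod_unfold)
  also have "\<dots> = p * c"
    using total[of "{m..<m + n}"] c(2) by (simp add: sum.cartesian_product atLeast0LessThan)
  finally have "p * (n * (n * p + 1)) \<le> p * (2 * c)" by (simp add: algebra_simps)
  then have "n * (n * p + 1) \<le> 2 * c" using assms(4) by simp
  then show "2 * n * (n * p + 1) \<le> (m + n) * ((m + n) * p + 1)"
    using 4 by (simp add: N_def)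
qed

section \<open>Sufficiency\<close>

lemma MCR_exists_if:
  assumes "even m" "0 < m" "m \<le> n" "0 < p" "(m + n) mod 4 = 0"
    and le: "2 * n * (n * p + 1) \<le> (m + n) * ((m + n) * p + 1)"
  shows "MCR_exists m n p"
proof -
  obtain a where a: "m = 2 * a" using assms(1) by blast
  have "\<exists>d. n = 2 * a + 4 * d"
    using assms(3,5) unfolding a by presburger
  then obtain d where n: "n = 2 * a + 4 * d" by blast
  define e where "e = a + d"
  define b where "b = a + 2 * d"
  define r where "r = d mod p"
  have b: "n = 2 * b" by (simp add: n b_def)
  have r: "r < p" using assms by (simp add: r_def)
  have a0: "0 < a" using assms a by simp
  have dp: "d = p * (d div p) + r" by (simp add: r_def)
  \<comment> \<open>\<open>T\<close> is the index sum required of the first block. All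
    \<open>4 * e\<close> indices sum to \<open>2 * e * (4 * e - 1)\<close> and
    \<open>b - a = 2 * d\<close>, so \<open>balance\<close> becomes
    \<open>p * T + r = p * (e * (4 * e - 1) + d) + d\<close>. Dividing the last \<open>d\<close> by
    \<open>p\<close> with remainder yields \<open>T\<close> and \<open>r\<close>.\<close>
  define T where "T = e * (4 * e - 1) + d + d div p"
  have min: "\<Sum>{..<m} = a * (2 * a - 1)" using sum_nat_lessThan_double[of m] by (simp add: a)
  define t where "t = T - \<Sum>{..<m}"
  have "a * (2 * a - 1) \<le> e * (4 * e - 1)"
    unfolding e_def by (intro mult_le_mono) auto
  then have T: "T = \<Sum>{..<m} + t" by (simp add: t_def T_def min)
  have iT: "int T = int e * (4 * int e - 1) + int d + int (d div p)"
    using a0 by (simp add: T_def e_def of_nat_diff)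
  have imin: "int (\<Sum>{..<m}) = int a * (2 * int a - 1)"
    unfolding min using a0 by (simp add: of_nat_diff)
  have idp: "int d = int p * int (d div p) + int r" using dp by (metis of_nat_add of_nat_mult)
  have "int (2 * n * (n * p + 1)) \<le> int ((m + n) * ((m + n) * p + 1))"
    using le by (simp only: of_nat_le_iff)
  then have "int p * (2 * (int e)^2 - 4 * int e * int d - 2 * (int d)^2) \<ge> int d"
    by (simp add: a n e_def algebra_simps power2_eq_square)
  moreover have "int t = int e * (4 * int e - 1) + int d + int (d div p) - int a * (2 * int a - 1)"
    using T iT imin by linarith
  then have "int p * int t + int r =
      int p * (int e * (4 * int e - 1) + int d - int a * (2 * int a - 1)) + int d"
    using idp by algebra
  ultimately have "int p * int t + int r \<le> int p * int (m * n)"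
    by (simp add: a n e_def algebra_simps power2_eq_square)
  \<comment> \<open>Keeping \<open>r\<close> in the bound matters: for \<open>0 < r\<close> it
    forces \<open>t < m * n\<close>, which supplies the separated pair.\<close>
  then have ptr: "p * t + r \<le> p * (m * n)" by (metis of_nat_add of_nat_le_iff of_nat_mult)
  then have t: "t \<le> m * n" using assms(4) by (metis add_leD1 mult_le_cancel1)
  obtain \<pi> where \<pi>: "bij_betw \<pi> {..<m + n} {..<m + n}" "(\<Sum>i<m. \<pi> i) = T"
    and adj: "t < m * n \<longrightarrow> \<pi> m = Suc (\<pi> 0)"
    using exists_row_permutation[OF t assms(2)] T by auto
  have "2 \<le> b \<and> \<pi> m = Suc (\<pi> 0)" if "0 < r"
  proof -
    have "d \<noteq> 0" using that by (cases "d = 0") (simp_all add: r_def)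
    moreover have "t \<noteq> m * n" using ptr that by auto
    ultimately show ?thesis using adj t by (auto simp: b_def)
  qed
  moreover have "p * T + r + a * (p - 1) + 2 * a + r =
      p * (\<Sum>i\<in>{m..<m + n}. \<pi> i) + b * (p - 1) + 2 * b"
  proof -
    have "(\<Sum>i<m. \<pi> i) + (\<Sum>i\<in>{m..<m + n}. \<pi> i) = (\<Sum>i<m + n. \<pi> i)"
      using sum.atLeastLessThan_concat[of 0 m "m + n" \<pi>] by (simp add: atLeast0LessThan)
    also have "\<dots> = \<Sum>{..<m + n}" using sum.reindex_bij_betw[OF \<pi>(1), of "\<lambda>x. x"] by simp
    also have "\<dots> = 2 * e * (4 * e - 1)"
      using sum_nat_lessThan_double[of "m + n"] by (simp add: a n e_def algebra_simps)
    finally have "int (T + (\<Sum>i\<in>{m..<m + n}. \<pi> i)) = int (2 * e * (4 * e - 1))"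
      by (simp only: \<pi>(2))
    then have "int (\<Sum>i\<in>{m..<m + n}. \<pi> i) = 2 * int e * (4 * int e - 1) - int T"
      using a0 by (simp add: e_def of_nat_diff del: of_nat_sum)
    moreover have "int (p - 1) = int p - 1" using assms(4) by simp
    moreover have "int b = int a + 2 * int d" by (simp add: b_def)
    ultimately have "int (p * T + r + a * (p - 1) + 2 * a + r) =
      int (p * (\<Sum>i\<in>{m..<m + n}. \<pi> i) + b * (p - 1) + 2 * b)"
      unfolding of_nat_add of_nat_mult of_nat_numeral using iT idp by algebra
    then show ?thesis by (simp only: of_nat_eq_iff)
  qed
  ultimately show ?thesis
    using MCR_exists_from_permutation[of \<pi> a b r p] \<pi> a0 r by (simp add: a b)
qed

section \<open>Equivalence of the integer bound with condition (ii)\<close>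

text \<open>Multiplying by \<open>4 * p\<close> and completing squares turns the bound into
  \<open>2 * Y^2 - X^2 \<le> 1\<close>, while the inequality with \<open>sqrt 2\<close> says
  \<open>2 * Y^2 - X^2 \<le> 0\<close>. By integrality the two differ only in the value 1.\<close>

lemma block_bound_iff:
  fixes m n p :: nat
  assumes "0 < p"
  shows "2 * n * (n * p + 1) \<le> (m + n) * ((m + n) * p + 1) \<longleftrightarrow>
    (1::int) = 2 * (2 * int p * int n + 1)^2 - (2 * int p * int m + 2 * int p * int n + 1)^2
     \<or> real m \<ge> (sqrt 2 - 1) * real n + (sqrt 2 - 1) / (2 * real p)"
proof -
  define X Y where "X = 2 * int p * int m + 2 * int p * int n + 1" and "Y = 2 * int p * int n + 1"
  have X: "0 \<le> X" and Y: "0 \<le> Y" by (simp_all add: X_def Y_def)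
  have "real m \<ge> (sqrt 2 - 1) * real n + (sqrt 2 - 1) / (2 * real p) \<longleftrightarrow>
      2 * real p * real m \<ge> 2 * real p * ((sqrt 2 - 1) * real n + (sqrt 2 - 1) / (2 * real p))"
    using assms by simp
  also have "2 * real p * ((sqrt 2 - 1) * real n + (sqrt 2 - 1) / (2 * real p)) =
      (sqrt 2 - 1) * Y"
    using assms by (simp add: Y_def field_simps)
  also have "(\<dots> \<le> 2 * real p * real m) \<longleftrightarrow> sqrt 2 * Y \<le> X"
    by (simp add: X_def Y_def algebra_simps)
  also have "\<dots> \<longleftrightarrow> (sqrt 2 * Y)^2 \<le> (real_of_int X)^2"
    using X Y by (intro abs_le_square_iff[THEN iffD1, THEN iffI]) auto
  also have "\<dots> \<longleftrightarrow> 2 * Y^2 \<le> X^2"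
  proof -
    have "(sqrt 2 * Y)^2 = real_of_int (2 * Y^2)" by (simp add: power_mult_distrib)
    then show ?thesis by (simp only: of_int_le_iff flip: of_int_power)
  qed
  finally have real_iff: "real m \<ge> (sqrt 2 - 1) * real n + (sqrt 2 - 1) / (2 * real p) \<longleftrightarrow>
    2 * Y^2 \<le> X^2" .
  have "2 * n * (n * p + 1) \<le> (m + n) * ((m + n) * p + 1) \<longleftrightarrow>
     int (4 * p) * int (2 * n * (n * p + 1)) \<le> int (4 * p) * int ((m + n) * ((m + n) * p + 1))"
    using assms by (simp del: of_nat_mult of_nat_add)
  also have "\<dots> \<longleftrightarrow> 2 * Y^2 - X^2 \<le> 1"
    by (simp add: X_def Y_def algebra_simps power2_eq_square)
  finally show ?thesis using real_iff unfolding X_def Y_def by linarith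
qed

theorem theorem8:
  fixes m n p :: nat
  assumes "even m" and "even n" and "0 < m" and "m \<le> n" and "0 < p"
  shows "MCR_exists m n p \<longleftrightarrow>
           ((m + n) mod 4 = 0 \<and>
            ((1::int) = 2 * (2 * int p * int n + 1)^2 - (2 * int p * int m + 2 * int p * int n + 1)^2
             \<or> real m \<ge> (sqrt 2 - 1) * real n + (sqrt 2 - 1) / (2 * real p)))"
  unfolding block_bound_iff[OF \<open>0 < p\<close>, symmetric]
  using MCR_exists_imp[of m n p] MCR_exists_if[of m n p] assms by metis

end
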